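(* Suppose $\mathfrak p$ is weakly compatible with $i(\bar{\mathfrak g})$. Then Condition A holds, i.e., $$0\notin\mathcal C\iff 0\notin\mathcal C'.$$
   Context: The base field is $\mathbb C$. $\mathfrak g,\bar{\mathfrak g}$ are finite-dimensional reductive Lie algebras and $i:\bar{\mathfrak g}\hookrightarrow\mathfrak g$ is an embedding such that $i(\bar{\mathfrak g})$ is reductive in $\mathfrak g$ (every irreducible finite-dimensional $\mathfrak g$-module is semisimple over $i(\bar{\mathfrak g})$). Cartan subalgebras $\bar{\mathfrak h}\subset\bar{\mathfrak g}$, $\mathfrak h\subset\mathfrak g$ with $i(\bar{\mathfrak h})\subset\mathfrak h$ and Borel subalgebras $\bar{\mathfrak b}\supset\bar{\mathfrak h}$, $\mathfrak b\supset\mathfrak h$ with $i(\bar{\mathfrak b})\subset\mathfrak b$ are fixed. $\mathfrak p\supset\mathfrak b$ is a parabolic subalgebra of $\mathfrak g$, and $\bar{\mathfrak p}:=i^{-1}(i(\bar{\mathfrak g})\cap\mathfrak p)$, a parabolic subalgebra of $\bar{\mathfrak g}$ containing $\bar{\mathfrak b}$. $\mathfrak n,\bar{\mathfrak n}$ are the nilradicals of $\mathfrak p,\bar{\mathfrak p}$ and $\mathfrak n_-,\bar{\mathfrak n}_-$ their opposites; $\bar{\mathfrak l}\supset\bar{\mathfrak h}$ is the reductive Levi part of $\bar{\mathfrak p}$. $\mathfrak n_-$ is an $\bar{\mathfrak l}$-module under $\mathrm{ad}\circ i$. $\Delta(\mathfrak g)$ is the root system of $\mathfrak g$ with respect to $\mathfrak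 h$. Let $N$ be any $\bar{\mathfrak l}$-submodule of $\mathfrak n_-$ isomorphic to $\bar{\mathfrak n}_-$ (one exists). For a tuple $X$ of elements of $\bar{\mathfrak h}^*$, $\mathrm{Cone}_{\mathbb Z_{>0}}(X)$ is the set of all finite nonempty linear combinations of elements of $X$ with coefficients in $\mathbb Z_{>0}$. Put $\mathcal C:=\mathrm{Cone}_{\mathbb Z_{>0}}(\bar{\mathfrak h}\text{-weights of }\mathfrak n_-/N)$ and $\mathcal C':=\mathrm{Cone}_{\mathbb Z_{>0}}(\bar{\mathfrak h}\text{-weights of }\mathfrak n_-)$ (weights with multiplicities). Condition A: exactly one of "$0\in\mathcal C$" and "$0\notin\mathcal C'$" holds. $\mathfrak p$ is weakly compatible with $i(\bar{\mathfrak g})$ if there exists $\bar h\in\bar{\mathfrak h}$ such that $\gamma(i(\bar h))\in\mathbb Q$ for all $\gamma\in\Delta(\mathfrak g)$, $\alpha(\bar h)>0$ for all $\bar{\mathfrak h}$-weights $\alpha$ of $\bar{\mathfrak n}$, and $\beta(i(\bar h))\ge0$ for all $\mathfrak h$-weights $\beta$ of $\mathfrak n$. *)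

theory Defs
  imports Complex_Main "HOL-Library.Function_Algebras"
begin

section \<open>Modules given by a set of operators\<close>

text \<open>
  A set \<open>S\<close> acts through \<open>act\<close> on a linear subspace \<open>V\<close> of an ambient complex vector space
  with scalar multiplication \<open>sc\<close>.
\<close>

definition submodule ::
  "(complex \<Rightarrow> 'v::ab_group_add \<Rightarrow> 'v) \<Rightarrow> 'g set \<Rightarrow> ('g \<Rightarrow> 'v \<Rightarrow> 'v) \<Rightarrow> 'v set \<Rightarrow> 'v set \<Rightarrow> bool"
  where "submodule sc S act V W \<longleftrightarrow>
    module.subspace sc W \<and> W \<subseteq> V \<and> (\<forall>x\<in>S. \<forall>w\<in>W. act x w \<in> W)"

definition direct_sum :: "'v::ab_group_add set \<Rightarrow> 'v set \<Rightarrow> 'v set \<Rightarrow> bool"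
  where "direct_sum V W W' \<longleftrightarrow> V = {w + w' |w w'. w \<in> W \<and> w' \<in> W'} \<and> W \<inter> W' = {0}"

definition irreducible_module ::
  "(complex \<Rightarrow> 'v::ab_group_add \<Rightarrow> 'v) \<Rightarrow> 'g set \<Rightarrow> ('g \<Rightarrow> 'v \<Rightarrow> 'v) \<Rightarrow> 'v set \<Rightarrow> bool"
  where "irreducible_module sc S act V \<longleftrightarrow>
    V \<noteq> {0} \<and> (\<forall>W. submodule sc S act V W \<longrightarrow> W = {0} \<or> W = V)"

definition semisimple_module ::
  "(complex \<Rightarrow> 'v::ab_group_add \<Rightarrow> 'v) \<Rightarrow> 'g set \<Rightarrow> ('g \<Rightarrow> 'v \<Rightarrow> 'v) \<Rightarrow> 'v set \<Rightarrow> bool"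
  where "semisimple_module sc S act V \<longleftrightarrow>
    (\<forall>W. submodule sc S act V W \<longrightarrow> (\<exists>W'. submodule sc S act V W' \<and> direct_sum V W W'))"

definition isomorphic_modules ::
  "'g set \<Rightarrow> (complex \<Rightarrow> 'v::ab_group_add \<Rightarrow> 'v) \<Rightarrow> ('g \<Rightarrow> 'v \<Rightarrow> 'v) \<Rightarrow> 'v set \<Rightarrow>
    (complex \<Rightarrow> 'w::ab_group_add \<Rightarrow> 'w) \<Rightarrow> ('g \<Rightarrow> 'w \<Rightarrow> 'w) \<Rightarrow> 'w set \<Rightarrow> bool"
  where "isomorphic_modules S scV actV V scW actW W \<longleftrightarrow>
    (\<exists>f. bij_betw f V W
       \<and> (\<forall>u\<in>V. \<forall>v\<in>V. f (u + v) = f u + f v)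
       \<and> (\<forall>c. \<forall>v\<in>V. f (scV c v) = scW c (f v))
       \<and> (\<forall>x\<in>S. \<forall>v\<in>V. f (actV x v) = actW x (f v)))"


section \<open>Weights\<close>

text \<open>
  Elements of the dual of a subspace \<open>H\<close> are represented by functions on the ambient type that
  vanish outside \<open>H\<close>, so that equality in the dual is equality of functions.
\<close>

definition dual_space :: "(complex \<Rightarrow> 'h::ab_group_add \<Rightarrow> 'h) \<Rightarrow> 'h set \<Rightarrow> ('h \<Rightarrow> complex) set"
  where "dual_space sc H = {\<gamma>.
    (\<forall>x\<in>H. \<forall>y\<in>H. \<gamma> (x + y) = \<gamma> x + \<gamma> y) \<and> (\<forall>c. \<forall>x\<in>H. \<gamma> (sc c x) = c * \<gamma> x) \<and>
    (\<forall>x. x \<notin> H \<longrightarrow> \<gamma> x = 0)}"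

text \<open>
  The quotient module \<open>V/N\<close> is handled through representatives: \<open>quot_weight_space\<close> is the
  preimage in \<open>V\<close> of the \<open>\<gamma>\<close>-weight space of \<open>V/N\<close>. For \<open>N = {0}\<close> this is the ordinary weight
  space of \<open>V\<close>.
\<close>

definition quot_weight_space ::
  "(complex \<Rightarrow> 'v::ab_group_add \<Rightarrow> 'v) \<Rightarrow> 'h set \<Rightarrow> ('h \<Rightarrow> 'v \<Rightarrow> 'v) \<Rightarrow> 'v set \<Rightarrow> 'v set \<Rightarrow>
    ('h \<Rightarrow> complex) \<Rightarrow> 'v set"
  where "quot_weight_space sc H act V N \<gamma> = {v \<in> V. \<forall>h\<in>H. act h v - sc (\<gamma> h) v \<in> N}"

abbreviation weight_space ::
  "(complex \<Rightarrow> 'v::ab_group_add \<Rightarrow> 'v) \<Rightarrow> 'h set \<Rightarrow> ('h \<Rightarrow> 'v \<Rightarrow> 'v) \<Rightarrow> 'v set \<Rightarrow>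
    ('h \<Rightarrow> complex) \<Rightarrow> 'v set"
  where "weight_space sc H act V \<equiv> quot_weight_space sc H act V {0}"

definition weights ::
  "(complex \<Rightarrow> 'h::ab_group_add \<Rightarrow> 'h) \<Rightarrow> (complex \<Rightarrow> 'v::ab_group_add \<Rightarrow> 'v) \<Rightarrow> 'h set \<Rightarrow>
    ('h \<Rightarrow> 'v \<Rightarrow> 'v) \<Rightarrow> 'v set \<Rightarrow> ('h \<Rightarrow> complex) set"
  where "weights scH sc H act V =
    {\<gamma> \<in> dual_space scH H. \<exists>v\<in>weight_space sc H act V \<gamma>. v \<noteq> 0}"

text \<open>
  The tuple of weights of \<open>V/N\<close> counted with multiplicity is the family \<open>fst\<close> over this index
  set: a weight \<open>\<gamma>\<close> occurs as \<open>(\<gamma>, 0), \<dots>, (\<gamma>, m - 1)\<close>, where \<open>m\<close> is the dimension of its weight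
  space in \<open>V/N\<close>.
\<close>

definition quot_weight_index ::
  "(complex \<Rightarrow> 'h::ab_group_add \<Rightarrow> 'h) \<Rightarrow> (complex \<Rightarrow> 'v::ab_group_add \<Rightarrow> 'v) \<Rightarrow> 'h set \<Rightarrow>
    ('h \<Rightarrow> 'v \<Rightarrow> 'v) \<Rightarrow> 'v set \<Rightarrow> 'v set \<Rightarrow> (('h \<Rightarrow> complex) \<times> nat) set"
  where "quot_weight_index scH sc H act V N =
    {(\<gamma>, k). \<gamma> \<in> dual_space scH H \<and>
       k < vector_space.dim sc (quot_weight_space sc H act V N \<gamma>) - vector_space.dim sc N}"

definition cone_pos_int :: "'j set \<Rightarrow> ('j \<Rightarrow> 'h \<Rightarrow> complex) \<Rightarrow> ('h \<Rightarrow> complex) set"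
  where "cone_pos_int I f =
    {(\<lambda>x. \<Sum>j\<in>J. of_nat (c j) * f j x) |J c :: 'j \<Rightarrow> nat.
       finite J \<and> J \<noteq> {} \<and> J \<subseteq> I \<and> (\<forall>j\<in>J. c j > 0)}"


section \<open>Lie algebras\<close>

definition fun_scale :: "complex \<Rightarrow> (nat \<Rightarrow> complex) \<Rightarrow> nat \<Rightarrow> complex"
  where "fun_scale c f = (\<lambda>k. c * f k)"

lemma vector_space_fun_scale: "vector_space fun_scale"
  by unfold_locales (auto simp: fun_scale_def fun_eq_iff algebra_simps)

locale fd_lie_algebra = vector_space scale
  for scale :: "complex \<Rightarrow> 'a::ab_group_add \<Rightarrow> 'a" +
  fixes bracket :: "'a \<Rightarrow> 'a \<Rightarrow> 'a"
  assumes finite_dim: "\<exists>B. finite B \<and> span B = UNIV"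
    and bracket_add_left: "bracket (x + y) z = bracket x z + bracket y z"
    and bracket_add_right: "bracket x (y + z) = bracket x y + bracket x z"
    and bracket_scale_left: "bracket (scale c x) y = scale c (bracket x y)"
    and bracket_scale_right: "bracket x (scale c y) = scale c (bracket x y)"
    and bracket_self: "bracket x x = 0"
    and jacobi: "bracket x (bracket y z) + bracket y (bracket z x) + bracket z (bracket x y) = 0"
begin

definition bracket_span :: "'a set \<Rightarrow> 'a set \<Rightarrow> 'a set"
  where "bracket_span A B = span {bracket x y |x y. x \<in> A \<and> y \<in> B}"

definition subalgebra :: "'a set \<Rightarrow> bool"
  where "subalgebra L \<longleftrightarrow> subspace L \<and> (\<forall>x\<in>L. \<forall>y\<in>L. bracket x y \<in> L)"

definition ideal_of :: "'a set \<Rightarrow> 'a set \<Rightarrow> bool"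
  where "ideal_of L I \<longleftrightarrow> submodule scale L bracket L I"

definition solvable :: "'a set \<Rightarrow> bool"
  where "solvable L \<longleftrightarrow> (\<exists>n. ((\<lambda>I. bracket_span I I) ^^ n) L = {0})"

definition nilpotent :: "'a set \<Rightarrow> bool"
  where "nilpotent L \<longleftrightarrow> (\<exists>n. (bracket_span L ^^ n) L = {0})"

text \<open>Reductive: the adjoint representation is semisimple, i.e. every ideal has a complementary
  ideal.\<close>

definition reductive :: "'a set \<Rightarrow> bool"
  where "reductive L \<longleftrightarrow> subalgebra L \<and> semisimple_module scale L bracket L"

definition cartan_subalgebra :: "'a set \<Rightarrow> bool"
  where "cartan_subalgebra H \<longleftrightarrow>
    subalgebra H \<and> nilpotent H \<and> {x. \<forall>y\<in>H. bracket x y \<in> H} = H"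

definition borel_subalgebra :: "'a set \<Rightarrow> bool"
  where "borel_subalgebra B \<longleftrightarrow> subalgebra B \<and> solvable B \<and>
    (\<forall>B'. subalgebra B' \<and> solvable B' \<and> B \<subseteq> B' \<longrightarrow> B' = B)"

definition parabolic_subalgebra :: "'a set \<Rightarrow> bool"
  where "parabolic_subalgebra P \<longleftrightarrow> subalgebra P \<and> (\<exists>B. borel_subalgebra B \<and> B \<subseteq> P)"

definition nilradical :: "'a set \<Rightarrow> 'a set"
  where "nilradical L = span (\<Union>{I. ideal_of L I \<and> nilpotent I})"

text \<open>
  The nilradical of a parabolic subalgebra \<open>P\<close> is meant in the sense of the decomposition of \<open>P\<close>
  into its reductive Levi part and its nilradical. The largest nilpotent ideal of \<open>P\<close> itself would
  also contain the centre of the reductive algebra, which belongs to the Levi part; intersecting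
  with the derived algebra removes it (and changes nothing if the algebra is semisimple).
\<close>

definition parabolic_nilradical :: "'a set \<Rightarrow> 'a set"
  where "parabolic_nilradical P = nilradical (P \<inter> bracket_span UNIV UNIV)"

definition levi_part :: "'a set \<Rightarrow> 'a set \<Rightarrow> 'a set \<Rightarrow> bool"
  where "levi_part H P L \<longleftrightarrow> reductive L \<and> H \<subseteq> L \<and> direct_sum P L (parabolic_nilradical P)"

definition opposite :: "'a set \<Rightarrow> 'a set \<Rightarrow> 'a set"
  where "opposite H n =
    span (\<Union>\<beta>\<in>weights scale scale H bracket n. weight_space scale H bracket UNIV (\<lambda>x. - \<beta> x))"

definition roots :: "'a set \<Rightarrow> ('a \<Rightarrow> complex) set"
  where "roots H = weights scale scale H bracket UNIV - {0}"

definition fd_module ::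
  "(complex \<Rightarrow> 'v::ab_group_add \<Rightarrow> 'v) \<Rightarrow> ('a \<Rightarrow> 'v \<Rightarrow> 'v) \<Rightarrow> 'v set \<Rightarrow> bool"
  where "fd_module sc act V \<longleftrightarrow>
    (\<exists>B. finite B \<and> V = module.span sc B)
    \<and> (\<forall>x. \<forall>v\<in>V. act x v \<in> V)
    \<and> (\<forall>x y. \<forall>v\<in>V. act (x + y) v = act x v + act y v)
    \<and> (\<forall>c x. \<forall>v\<in>V. act (scale c x) v = sc c (act x v))
    \<and> (\<forall>x. \<forall>v\<in>V. \<forall>w\<in>V. act x (v + w) = act x v + act x w)
    \<and> (\<forall>c x. \<forall>v\<in>V. act x (sc c v) = sc c (act x v))
    \<and> (\<forall>x y. \<forall>v\<in>V. act (bracket x y) v = act x (act y v) - act y (act x v))"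

text \<open>
  All finite-dimensional modules are covered up to isomorphism, since every finite-dimensional
  complex vector space is isomorphic to a subspace of \<open>nat \<Rightarrow> complex\<close>.
\<close>

definition reductive_in :: "'a set \<Rightarrow> bool"
  where "reductive_in S \<longleftrightarrow>
    (\<forall>V act. fd_module fun_scale act V \<and> irreducible_module fun_scale UNIV act V
       \<longrightarrow> semisimple_module fun_scale S act V)"

end

locale reductive_lie_algebra = fd_lie_algebra +
  assumes reductive_UNIV: "reductive UNIV"

locale lie_algebra_embedding =
  K: fd_lie_algebra scK brK + G: fd_lie_algebra scG brG
  for scK :: "complex \<Rightarrow> 'k::ab_group_add \<Rightarrow> 'k" and brK :: "'k \<Rightarrow> 'k \<Rightarrow> 'k"
    and scG :: "complex \<Rightarrow> 'g::ab_group_add \<Rightarrow> 'g" and brG :: "'g \<Rightarrow> 'g \<Rightarrow> 'g" +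
  fixes i :: "'k \<Rightarrow> 'g"
  assumes linear_i: "Vector_Spaces.linear scK scG i"
    and bracket_i: "i (brK x y) = brG (i x) (i y)"
    and inj_i: "inj i"
begin

text \<open>The order relations on complex values include the assertion that the values are real.\<close>

definition weakly_compatible :: "'k set \<Rightarrow> 'g set \<Rightarrow> 'g set \<Rightarrow> bool"
  where "weakly_compatible hbar h p \<longleftrightarrow>
    (\<exists>x\<in>hbar.
       (\<forall>\<gamma>\<in>G.roots h. \<gamma> (i x) \<in> \<rat>)
       \<and> (\<forall>\<alpha>\<in>weights scK scK hbar brK
              (K.parabolic_nilradical (i -` (range i \<inter> p))).
            \<alpha> x \<in> \<real> \<and> Re (\<alpha> x) > 0)
       \<and> (\<forall>\<beta>\<in>weights scG scG h brG (G.parabolic_nilradical p).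
            \<beta> (i x) \<in> \<real> \<and> Re (\<beta> (i x)) \<ge> 0))"

end

definition condition_A :: "('h \<Rightarrow> complex) set \<Rightarrow> ('h \<Rightarrow> complex) set \<Rightarrow> bool"
  where "condition_A C C' \<longleftrightarrow> (0 \<in> C) \<noteq> (0 \<notin> C')"

end

theory Submission
  imports Defs
begin

text \<open>
  Both \<open>n_minus\<close> and \<open>nbar_minus\<close> are spanned by weight vectors. Hence every weight of
  \<open>n_minus/N\<close> is a weight of \<open>n_minus\<close>, so \<open>0 \<in> C\<close> implies \<open>0 \<in> C'\<close>. Conversely, let \<open>x\<close>
  witness weak compatibility. The weights of \<open>n_minus\<close> are nonpositive at \<open>x\<close>, so those occurring
  in a positive combination equal to \<open>0\<close> all vanish at \<open>x\<close>. The weights of \<open>N\<close> are negative at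
  \<open>x\<close>, so none of the corresponding weight vectors lies in \<open>N\<close>, and all weights in the combination
  are weights of \<open>n_minus/N\<close>.
\<close>

section \<open>Lifting weights from a quotient to spanning eigenvectors\<close>

text \<open>If no nonzero member of \<open>E\<close> had weight \<open>\<gamma>\<close>, the
  eigenvectors in an expression of \<open>v\<close> could be eliminated one at a time, each nonzero
  one by an operator that rescales \<open>v\<close> by a nonzero factor modulo \<open>N\<close>. The
  empty span that remains would put \<open>v\<close> into \<open>N\<close>.\<close>

lemma (in vector_space) quot_weight_of_span:
  assumes N: "subspace N" and stable: "\<And>h w. h \<in> H \<Longrightarrow> w \<in> N \<Longrightarrow> act h w \<in> N"
    and lin: "\<And>h. h \<in> H \<Longrightarrow> Vector_Spaces.linear scale scale (act h)"
    and eigen: "\<And>e. e \<in> E \<Longrightarrow> \<exists>\<delta>. \<forall>h\<in>H. act h e = scale (\<delta> h) e"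
    and v: "v \<in> span E" "v \<notin> N" "\<And>h. h \<in> H \<Longrightarrow> act h v - scale (\<gamma> h) v \<in> N"
  shows "\<exists>e\<in>E. e \<noteq> 0 \<and> (\<forall>h\<in>H. act h e = scale (\<gamma> h) e)"
proof (rule ccontr)
  assume none: "\<not> ?thesis"
  \<comment> \<open>The claim covers all vectors of the span, since the induction hypothesis is
    applied to a vector \<open>u\<close> other than \<open>v\<close>.\<close>
  have "v \<in> N" if "finite T" "T \<subseteq> E" "v \<in> span T" "\<forall>h\<in>H. act h v - scale (\<gamma> h) v \<in> N" for T v
    using that
  proof (induction T arbitrary: v rule: finite_induct)
    case empty
    then show ?case using N subspace_0 by simp
  next
    case (insert e T)
    obtain c where w: "v - scale c e \<in> span T"
      using insert.prems(2) span_breakdown_eq by blast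
    obtain \<delta> where \<delta>: "\<And>h. h \<in> H \<Longrightarrow> act h e = scale (\<delta> h) e"
      using eigen insert.prems(1) by blast
    show ?case
    proof (cases "e = 0")
      case True
      then show ?thesis using insert w by simp
    next
      case False
      then obtain h where h: "h \<in> H" "\<delta> h \<noteq> \<gamma> h"
        using none insert.prems(1) \<delta> by force
      interpret h: Vector_Spaces.linear scale scale "act h"
        by (rule lin) (rule h)
      \<comment> \<open>Applying \<open>act h - \<delta> h\<close> removes \<open>e\<close>, and modulo \<open>N\<close> only rescales \<open>v\<close>.\<close>
      define u where "u = act h v - scale (\<delta> h) v"
      define d where "d = act h v - scale (\<gamma> h) v"
      have d: "d \<in> N" using insert.prems(3) h d_def by simp
      have u_eq: "u = scale (\<gamma> h - \<delta> h) v + d"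
        by (simp add: u_def d_def algebra_simps)
      have span_inv: "act h y \<in> span T" if "y \<in> span T" for y
        using that
      proof (induction rule: span_induct_alt)
        case base
        then show ?case by (simp add: span_zero)
      next
        case (step c e' y)
        obtain \<delta>' where "act h e' = scale (\<delta>' h) e'"
          using eigen insert.prems(1) step h by blast
        then show ?case
          using step by (simp add: h.add h.scale span_add span_scale span_base)
      qed
      have "u = act h (v - scale c e) - scale (\<delta> h) (v - scale c e)"
        by (simp add: u_def h.diff h.scale \<delta>[OF h(1)] algebra_simps)
      then have u_span: "u \<in> span T"
        using span_inv[OF w] w by (simp add: span_diff span_scale)
      have "\<forall>g\<in>H. act g u - scale (\<gamma> g) u \<in> N"
      proof
        fix g assume g: "g \<in> H"
        interpret g: Vector_Spaces.linear scale scale "act g"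
          by (rule lin) (rule g)
        have "act g u - scale (\<gamma> g) u =
            scale (\<gamma> h - \<delta> h) (act g v - scale (\<gamma> g) v) + (act g d - scale (\<gamma> g) d)"
          by (simp add: u_eq g.add g.diff g.scale algebra_simps)
        then show "act g u - scale (\<gamma> g) u \<in> N"
          using insert.prems(3) g d stable N
          by (simp add: subspace_add subspace_diff subspace_scale)
      qed
      then have "u \<in> N" using insert.IH insert.prems(1) u_span by blast
      then have "scale (\<gamma> h - \<delta> h) v \<in> N"
        using subspace_diff[OF N _ d] u_eq by (metis add_diff_cancel_right')
      then have "scale (inverse (\<gamma> h - \<delta> h)) (scale (\<gamma> h - \<delta> h) v) \<in> N"
        by (rule subspace_scale[OF N])
      then show ?thesis using h by simp
    qed
  qed
  moreover obtain T where "finite T" "T \<subseteq> E" "v \<in> span T"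
  proof -
    obtain T r where "finite T" "T \<subseteq> E" "v = (\<Sum>a\<in>T. scale (r a) a)"
      using v(1) unfolding span_explicit by blast
    then show ?thesis
      using that by (simp add: span_sum span_scale span_base)
  qed
  ultimately show False using v by blast
qed

section \<open>Weight multiplicities and integer cones\<close>

text \<open>An index below the truncated difference of dimensions forces the preimage of the weight
  space to have larger dimension than \<open>N\<close>, so it cannot lie inside
  \<open>N\<close>.\<close>

lemma quot_weight_index_imp_vector:
  fixes scale :: "complex \<Rightarrow> 'v::ab_group_add \<Rightarrow> 'v"
  assumes fd: "finite_dimensional_vector_space scale B"
    and "(\<gamma>, k) \<in> quot_weight_index scH scale H act V N"
  obtains v where "v \<in> quot_weight_space scale H act V N \<gamma>" "v \<notin> N"
proof -
  interpret finite_dimensional_vector_space scale B by (rule fd)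
  have "\<not> quot_weight_space scale H act V N \<gamma> \<subseteq> N"
  proof
    assume "quot_weight_space scale H act V N \<gamma> \<subseteq> N"
    then have "dim (quot_weight_space scale H act V N \<gamma>) \<le> dim N" by (rule dim_subset)
    then show False using assms by (simp add: quot_weight_index_def)
  qed
  then show thesis using that by blast
qed

text \<open>Because \<open>N\<close> is stable, it is contained in the preimage of every weight
  space of the quotient; \<open>v\<close> makes the inclusion strict, so the multiplicity is at
  least one.\<close>

lemma quot_weight_indexI:
  fixes scale :: "complex \<Rightarrow> 'v::ab_group_add \<Rightarrow> 'v"
  assumes fd: "finite_dimensional_vector_space scale B"
    and N: "submodule scale H act V N" and "\<gamma> \<in> dual_space scH H"
    and v: "v \<in> quot_weight_space scale H act V N \<gamma>" "v \<notin> N"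
  shows "(\<gamma>, 0) \<in> quot_weight_index scH scale H act V N"
proof -
  interpret finite_dimensional_vector_space scale B by (rule fd)
  let ?Q = "quot_weight_space scale H act V N \<gamma>"
  have sub: "subspace N" using N by (simp add: submodule_def)
  have "N \<subseteq> ?Q"
    using N by (auto simp: submodule_def quot_weight_space_def intro!: subspace_diff subspace_scale)
  then have "span N \<subseteq> span ?Q" by (rule span_mono)
  moreover have "v \<in> span ?Q" "v \<notin> span N"
    using v sub by (auto simp: span_base span_eq_iff[THEN iffD2])
  ultimately have "dim N < dim ?Q" by (intro dim_psubset) blast
  then show ?thesis using assms by (simp add: quot_weight_index_def)
qed

text \<open>Copies of one weight can be merged into the single index \<open>(\<gamma>, 0)\<close> by
  adding their coefficients. Comparing cones thus reduces to comparing which weights occur.\<close>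

lemma cone_pos_int_fst_transfer:
  fixes I' :: "(('h \<Rightarrow> complex) \<times> nat) set" and c :: "('h \<Rightarrow> complex) \<times> nat \<Rightarrow> nat"
  assumes J: "finite J" "J \<noteq> {}" "\<forall>j\<in>J. c j > 0" and I': "\<forall>j\<in>J. (fst j, 0) \<in> I'"
  shows "(\<lambda>x. \<Sum>j\<in>J. of_nat (c j) * fst j x) \<in> cone_pos_int I' fst"
proof -
  define \<phi> :: "('h \<Rightarrow> complex) \<times> nat \<Rightarrow> ('h \<Rightarrow> complex) \<times> nat" where "\<phi> j = (fst j, 0)" for j
  define c' where "c' j' = (\<Sum>j | j \<in> J \<and> \<phi> j = j'. c j)" for j'
  have "c' j' > 0" if "j' \<in> \<phi> ` J" for j'
  proof -
    obtain j where j: "j \<in> J" "\<phi> j = j'" using \<open>j' \<in> \<phi> ` J\<close> by blast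
    have "c j \<le> c' j'" unfolding c'_def by (rule member_le_sum) (use J j in auto)
    then show ?thesis using J(3) j by (metis gr_zeroI le_zero_eq less_irrefl)
  qed
  moreover have "(\<Sum>j\<in>J. of_nat (c j) * fst j x) = (\<Sum>j'\<in>\<phi> ` J. of_nat (c' j') * fst j' x)" for x
  proof -
    have "(\<Sum>j\<in>J. of_nat (c j) * fst j x) =
        (\<Sum>j'\<in>\<phi> ` J. \<Sum>j | j \<in> J \<and> \<phi> j = j'. of_nat (c j) * fst j x)"
      by (rule sum.image_gen) (rule J)
    also have "\<dots> = (\<Sum>j'\<in>\<phi> ` J. of_nat (c' j') * fst j' x)"
      unfolding c'_def of_nat_sum sum_distrib_right
      by (intro sum.cong refl) (auto simp: \<phi>_def)
    finally show ?thesis .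
  qed
  moreover have "\<phi> ` J \<subseteq> I'" using I' by (auto simp: \<phi>_def)
  ultimately show ?thesis
    unfolding cone_pos_int_def using J by (intro CollectI exI[of _ "\<phi> ` J"] exI[of _ c']) simp
qed

section \<open>Weights of the opposite of a nilradical\<close>

context fd_lie_algebra
begin

lemma finite_dimensional: obtains B where "finite_dimensional_vector_space scale B"
proof -
  obtain F where F: "finite F" "span F = UNIV" using finite_dim by blast
  obtain B where "B \<subseteq> F" "independent B" "F \<subseteq> span B"
    using maximal_independent_subset by blast
  moreover from this have "span B = UNIV" using F span_mono span_span by blast
  ultimately have "finite_dimensional_vector_space scale B"
    using F by unfold_locales (auto intro: finite_subset)
  then show thesis by (rule that)
qed

lemma linear_bracket: "Vector_Spaces.linear scale scale (bracket x)"
  by unfold_locales (simp_all add: algebra_simps bracket_add_right bracket_scale_right)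

lemma bracket_zero_right: "bracket x 0 = 0"
  using bracket_add_right[of x 0 0] by simp

lemma subspace_opposite: "subspace (opposite H n)"
  by (simp add: opposite_def)

text \<open>The generators of the opposite are eigenvectors of \<open>H\<close>. This stability
  later keeps \<open>brK y u\<close> inside the set on which the isomorphism with \<open>N\<close>
  is injective.\<close>

lemma bracket_opposite:
  assumes "y \<in> H" "v \<in> opposite H n"
  shows "bracket y v \<in> opposite H n"
  using assms(2) unfolding opposite_def
proof (induction rule: span_induct_alt)
  case base
  then show ?case by (simp add: bracket_zero_right span_zero)
next
  case (step c e v)
  then obtain \<beta> where "bracket y e = scale (- \<beta> y) e"
    using assms(1) by (auto simp: quot_weight_space_def eq_neg_iff_add_eq_0)
  then show ?case
    using step by (auto simp: bracket_add_right bracket_scale_right simp del: scale_minus_left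
        intro!: span_add span_scale intro: span_base)
qed

text \<open>The weight vectors spanning the opposite are also eigenvectors of \<open>H'\<close>
  acting through \<open>f\<close>, so weights of the quotient lift to them. Leaving \<open>f\<close>
  and \<open>N\<close> open covers both the embedding \<open>i\<close> with \<open>N\<close> or
  \<open>{0}\<close> and the identity with \<open>{0}\<close>.\<close>

lemma opposite_weight:
  assumes f: "f ` H' \<subseteq> H" and N: "subspace N" "\<And>y w. y \<in> H' \<Longrightarrow> w \<in> N \<Longrightarrow> bracket (f y) w \<in> N"
    and v: "v \<in> quot_weight_space scale H' (\<lambda>y. bracket (f y)) (opposite H n) N \<gamma>" "v \<notin> N"
  obtains \<beta> e where "\<beta> \<in> weights scale scale H bracket n" "\<forall>y\<in>H'. \<gamma> y = - \<beta> (f y)"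
    "e \<noteq> 0" "e \<in> weight_space scale H' (\<lambda>y. bracket (f y)) (opposite H n) \<gamma>"
proof -
  let ?E = "\<Union>\<beta>\<in>weights scale scale H bracket n. weight_space scale H bracket UNIV (\<lambda>x. - \<beta> x)"
  have E: "\<exists>\<beta>\<in>weights scale scale H bracket n. \<forall>y\<in>H'. bracket (f y) e = scale (- \<beta> (f y)) e"
    if e: "e \<in> ?E" for e
  proof -
    obtain \<beta> where "\<beta> \<in> weights scale scale H bracket n"
      and "e \<in> weight_space scale H bracket UNIV (\<lambda>x. - \<beta> x)" using e by (rule UN_E)
    then show ?thesis using f
      by (intro bexI[of _ \<beta>]) (auto simp: quot_weight_space_def eq_neg_iff_add_eq_0)
  qed
  have "\<exists>e\<in>?E. e \<noteq> 0 \<and> (\<forall>y\<in>H'. bracket (f y) e = scale (\<gamma> y) e)"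
  proof (rule quot_weight_of_span[OF N(1), where v = v and act = "\<lambda>y. bracket (f y)"])
    show "v \<in> span ?E" using v by (simp add: quot_weight_space_def opposite_def)
    show "\<exists>\<delta>. \<forall>y\<in>H'. bracket (f y) e = scale (\<delta> y) e" if "e \<in> ?E" for e
      using E[OF that] by (elim bexE) (rule exI[of _ "\<lambda>y. - _ (f y)"])
  qed (use v N linear_bracket in \<open>auto simp: quot_weight_space_def\<close>)
  then obtain e where e: "e \<in> ?E" "e \<noteq> 0" "\<And>y. y \<in> H' \<Longrightarrow> bracket (f y) e = scale (\<gamma> y) e"
    by blast
  obtain \<beta> where \<beta>: "\<beta> \<in> weights scale scale H bracket n"
    "\<forall>y\<in>H'. bracket (f y) e = scale (- \<beta> (f y)) e" using E[OF e(1)] by blast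
  show thesis
  proof (rule that[OF \<beta>(1) _ e(2)])
    \<comment> \<open>Both sides are eigenvalues of the same nonzero vector
      \<open>e\<close>.\<close>
    show "\<forall>y\<in>H'. \<gamma> y = - \<beta> (f y)"
      using \<beta>(2) e(2,3) by (metis scale_right_imp_eq)
    show "e \<in> weight_space scale H' (\<lambda>y. bracket (f y)) (opposite H n) \<gamma>"
      using e unfolding quot_weight_space_def opposite_def by (auto intro: span_base)
  qed
qed

end

section \<open>Comparison of the two cones\<close>

theorem lemma3p7:
  fixes scG :: "complex \<Rightarrow> 'g::ab_group_add \<Rightarrow> 'g" and brG :: "'g \<Rightarrow> 'g \<Rightarrow> 'g"
    and scK :: "complex \<Rightarrow> 'k::ab_group_add \<Rightarrow> 'k" and brK :: "'k \<Rightarrow> 'k \<Rightarrow> 'k"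
    and i :: "'k \<Rightarrow> 'g"
    and h b p n n_minus N :: "'g set"
    and hbar bbar pbar nbar nbar_minus lbar :: "'k set"
    and C C' :: "('k \<Rightarrow> complex) set"
  assumes "reductive_lie_algebra scG brG"
    and "reductive_lie_algebra scK brK"
    and "lie_algebra_embedding scK brK scG brG i"
    and "fd_lie_algebra.reductive_in scG brG (range i)"
    and "fd_lie_algebra.cartan_subalgebra scK brK hbar"
    and "fd_lie_algebra.cartan_subalgebra scG brG h"
    and "i ` hbar \<subseteq> h"
    and "fd_lie_algebra.borel_subalgebra scK brK bbar" and "hbar \<subseteq> bbar"
    and "fd_lie_algebra.borel_subalgebra scG brG b" and "h \<subseteq> b"
    and "i ` bbar \<subseteq> b"
    and "fd_lie_algebra.parabolic_subalgebra scG brG p" and "b \<subseteq> p"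
    and "pbar = i -` (range i \<inter> p)"
    and "n = fd_lie_algebra.parabolic_nilradical scG brG p"
    and "nbar = fd_lie_algebra.parabolic_nilradical scK brK pbar"
    and "n_minus = fd_lie_algebra.opposite scG brG h n"
    and "nbar_minus = fd_lie_algebra.opposite scK brK hbar nbar"
    and "fd_lie_algebra.levi_part scK brK hbar pbar lbar"
    and "submodule scG lbar (\<lambda>x. brG (i x)) n_minus N"
    and "isomorphic_modules lbar scK brK nbar_minus scG (\<lambda>x. brG (i x)) N"
    and "C = cone_pos_int (quot_weight_index scK scG hbar (\<lambda>x. brG (i x)) n_minus N) fst"
    and "C' = cone_pos_int (quot_weight_index scK scG hbar (\<lambda>x. brG (i x)) n_minus {0}) fst"
    and "lie_algebra_embedding.weakly_compatible scK brK scG brG i hbar h p"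
  shows "condition_A C C' \<and> (0 \<notin> C \<longleftrightarrow> 0 \<notin> C')"
proof -
  interpret lie_algebra_embedding scK brK scG brG i by fact
  obtain B where "finite_dimensional_vector_space scG B" by (rule G.finite_dimensional)
  note index_imp_vector = quot_weight_index_imp_vector[OF this]
    and indexI = quot_weight_indexI[OF this]
  let ?act = "\<lambda>x. brG (i x)"
  have n_minus: "n_minus = G.opposite h n" and nbar_minus: "nbar_minus = K.opposite hbar nbar"
    by fact+
  \<comment> \<open>The Levi part contains \<open>hbar\<close>, so the \<open>lbar\<close>-submodule
    \<open>N\<close> and its \<open>lbar\<close>-isomorphism with \<open>nbar_minus\<close> carry
    information about \<open>hbar\<close>-weights.\<close>
  have "K.levi_part hbar pbar lbar" by fact
  then have hbar_lbar: "hbar \<subseteq> lbar" by (simp add: K.levi_part_def)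
  have N: "submodule scG hbar ?act n_minus N"
    using \<open>submodule scG lbar ?act n_minus N\<close> hbar_lbar by (auto simp: submodule_def)
  then have N_sub: "G.subspace N" and N_stable: "\<And>y w. y \<in> hbar \<Longrightarrow> w \<in> N \<Longrightarrow> ?act y w \<in> N"
    by (auto simp: submodule_def)
  \<comment> \<open>With \<open>{0}\<close> in place of \<open>N\<close>, the weights of
    \<open>n_minus\<close> itself fall under the lemmas on quotients.\<close>
  have zero: "submodule scG hbar ?act n_minus {0}"
    using G.subspace_0[OF G.subspace_opposite]
    by (simp add: submodule_def n_minus G.bracket_zero_right)
  then have zero_sub: "G.subspace {0}"
    and zero_stable: "\<And>y w. y \<in> hbar \<Longrightarrow> w \<in> {0} \<Longrightarrow> ?act y w \<in> {0}"
    by (auto simp: submodule_def)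
  obtain x where x: "x \<in> hbar"
    and pos: "\<And>\<alpha>. \<alpha> \<in> weights scK scK hbar brK nbar \<Longrightarrow> \<alpha> x \<in> \<real> \<and> Re (\<alpha> x) > 0"
    and nonneg: "\<And>\<beta>. \<beta> \<in> weights scG scG h brG n \<Longrightarrow> \<beta> (i x) \<in> \<real> \<and> Re (\<beta> (i x)) \<ge> 0"
    using \<open>weakly_compatible hbar h p\<close> assms(15-17) unfolding weakly_compatible_def by blast
  let ?I = "quot_weight_index scK scG hbar ?act n_minus N"
  let ?I' = "quot_weight_index scK scG hbar ?act n_minus {0}"

  \<comment> \<open>Only copy \<open>0\<close> is recorded, which suffices once repeated weights are
    merged.\<close>
  have I_I': "(\<gamma>, 0) \<in> ?I'" if I: "(\<gamma>, k) \<in> ?I" for \<gamma> k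
  proof -
    obtain v where "v \<in> quot_weight_space scG hbar ?act n_minus N \<gamma>" "v \<notin> N"
      using I by (rule index_imp_vector)
    then obtain e where "e \<noteq> 0" "e \<in> weight_space scG hbar ?act n_minus \<gamma>"
      using G.opposite_weight[OF \<open>i ` hbar \<subseteq> h\<close> N_sub N_stable] unfolding n_minus by blast
    moreover have "\<gamma> \<in> dual_space scK hbar" using I by (simp add: quot_weight_index_def)
    ultimately show ?thesis using indexI[OF zero] by blast
  qed

  have I'_nonpos: "\<gamma> x \<in> \<real> \<and> Re (\<gamma> x) \<le> 0" if I: "(\<gamma>, k) \<in> ?I'" for \<gamma> k
  proof -
    obtain v where "v \<in> weight_space scG hbar ?act n_minus \<gamma>" "v \<notin> {0}"
      using I by (rule index_imp_vector)
    then obtain \<beta> where "\<beta> \<in> weights scG scG h brG n" "\<forall>y\<in>hbar. \<gamma> y = - \<beta> (i y)"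
      using G.opposite_weight[OF \<open>i ` hbar \<subseteq> h\<close> zero_sub zero_stable] unfolding n_minus by blast
    then show ?thesis using nonneg x by auto
  qed

  \<comment> \<open>The vector is pulled back along the isomorphism to \<open>nbar_minus\<close>,
    where its weight is the negative of a weight of \<open>nbar\<close>; weak compatibility makes
    the latter strictly positive at \<open>x\<close>.\<close>
  have N_neg: "Re (\<gamma> x) < 0"
    if v: "v \<in> weight_space scG hbar ?act n_minus \<gamma>" "v \<noteq> 0" "v \<in> N" for \<gamma> v
  proof -
    obtain f where f: "bij_betw f nbar_minus N"
      and scale: "\<And>c w. w \<in> nbar_minus \<Longrightarrow> f (scK c w) = scG c (f w)"
      and act: "\<And>y w. y \<in> lbar \<Longrightarrow> w \<in> nbar_minus \<Longrightarrow> f (brK y w) = ?act y (f w)"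
      using \<open>isomorphic_modules lbar scK brK nbar_minus scG ?act N\<close>
      unfolding isomorphic_modules_def by blast
    obtain u where u: "u \<in> nbar_minus" "f u = v" using f v(3) by (auto simp: bij_betw_def)
    have sub: "K.subspace nbar_minus" unfolding nbar_minus by (rule K.subspace_opposite)
    have "u \<noteq> 0"
    proof
      assume "u = 0"
      \<comment> \<open>Homogeneity of \<open>f\<close> with scalar \<open>0\<close> replaces the
        statement that \<open>f\<close> sends \<open>0\<close> to \<open>0\<close>.\<close>
      then have "v = scG 0 (f u)" using scale[OF u(1), of 0] u(2) by simp
      then show False using v(2) by simp
    qed
    moreover have "u \<in> weight_space scK hbar brK nbar_minus \<gamma>"
    proof -
      have "brK y u = scK (\<gamma> y) u" if y: "y \<in> hbar" for y
      proof -
        have y': "y \<in> lbar" using y hbar_lbar by blast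
        have "f (brK y u) = ?act y v" using act[OF y' u(1)] u(2) by simp
        also have "\<dots> = f (scK (\<gamma> y) u)"
          using v(1) y scale[OF u(1)] u(2) by (simp add: quot_weight_space_def)
        finally have eq: "f (brK y u) = f (scK (\<gamma> y) u)" .
        \<comment> \<open>Injectivity of \<open>f\<close> holds only on \<open>nbar_minus\<close>,
          so both arguments must be shown to lie there before \<open>f\<close> is cancelled.\<close>
        have "scK (\<gamma> y) u \<in> nbar_minus" using sub u(1) by (rule K.subspace_scale)
        then show ?thesis
          using eq f K.bracket_opposite[OF y u(1)[unfolded nbar_minus]] nbar_minus u(1) by (auto simp: bij_betw_def dest: inj_onD)
      qed
      then show ?thesis using u(1) by (simp add: quot_weight_space_def)
    qed
    ultimately obtain \<alpha> where "\<alpha> \<in> weights scK scK hbar brK nbar" "\<forall>y\<in>hbar. \<gamma> y = - \<alpha> y"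
      using K.opposite_weight[of "\<lambda>y. y" hbar hbar "{0}" u nbar \<gamma>]
      by (auto simp: nbar_minus K.bracket_zero_right K.subspace_def)
    then show ?thesis using pos x by auto
  qed

  have I'_I: "(\<gamma>, 0) \<in> ?I" if I: "(\<gamma>, k) \<in> ?I'" and "\<gamma> x = 0" for \<gamma> k
  proof -
    obtain v where v: "v \<in> weight_space scG hbar ?act n_minus \<gamma>" "v \<notin> {0}"
      using I by (rule index_imp_vector)
    \<comment> \<open>A vector of this weight inside \<open>N\<close> would make
      \<open>\<gamma> x\<close> strictly negative.\<close>
    then have "v \<notin> N" using N_neg \<open>\<gamma> x = 0\<close> by fastforce
    moreover have "v \<in> quot_weight_space scG hbar ?act n_minus N \<gamma>"
      using v(1) N_sub by (auto simp: quot_weight_space_def G.subspace_0)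
    moreover have "\<gamma> \<in> dual_space scK hbar" using I by (simp add: quot_weight_index_def)
    ultimately show ?thesis using indexI[OF N] by blast
  qed

  have "C \<subseteq> C'"
  proof
    fix \<gamma> assume "\<gamma> \<in> C"
    then obtain J c where "finite J" "J \<noteq> {}" "J \<subseteq> ?I" "\<forall>j\<in>J. c j > 0"
      "\<gamma> = (\<lambda>y. \<Sum>j\<in>J. of_nat (c j) * fst j y)"
      unfolding \<open>C = _\<close> cone_pos_int_def by blast
    then show "\<gamma> \<in> C'" unfolding \<open>C' = _\<close>
      using I_I' by (auto intro!: cone_pos_int_fst_transfer)
  qed
  moreover have "0 \<in> C" if "0 \<in> C'"
  proof -
    obtain J c where J: "finite J" "J \<noteq> {}" "J \<subseteq> ?I'" "\<forall>j\<in>J. c j > 0"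
      and eq: "(0 :: 'k \<Rightarrow> complex) = (\<lambda>y. \<Sum>j\<in>J. of_nat (c j) * fst j y)"
      using \<open>0 \<in> C'\<close> unfolding \<open>C' = _\<close> cone_pos_int_def by blast
    \<comment> \<open>Evaluated at \<open>x\<close>, the vanishing combination is a sum of
      nonpositive reals with positive coefficients, so every term is zero.\<close>
    have "fst j x = 0" if "j \<in> J" for j
    proof -
      have np: "fst j x \<in> \<real> \<and> Re (fst j x) \<le> 0" if "j \<in> J" for j
        using I'_nonpos[of "fst j" "snd j"] J(3) that by auto
      have "0 = (\<Sum>j\<in>J. of_nat (c j) * fst j x)" using fun_cong[OF eq, of x] by simp
      then have "0 = Re (\<Sum>j\<in>J. of_nat (c j) * fst j x)" by (metis zero_complex.sel(1))
      then have "(\<Sum>j\<in>J. - (of_nat (c j) * Re (fst j x))) = 0" by (simp add: sum_negf)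
      then have "- (of_nat (c j) * Re (fst j x)) = 0"
        using J(1) np that by (subst (asm) sum_nonneg_eq_0_iff) (auto simp: mult_nonneg_nonpos)
      \<comment> \<open>Dividing by the positive coefficient kills the real part; the imaginary part
        vanishes because the value is real.\<close>
      then show ?thesis using J(4) that np[OF that] by (auto simp: complex_eq_iff complex_is_Real_iff)
    qed
    then have "\<forall>j\<in>J. (fst j, 0) \<in> ?I" using I'_I J(3) by force
    then show ?thesis
      unfolding \<open>C = _\<close> eq using J by (intro cone_pos_int_fst_transfer)
  qed
  ultimately show ?thesis by (auto simp: condition_A_def)
qed

end
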